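(* Let $s\ge 1$ be an integer. The largest size of a self-conjugate $(s,s+1,s+2)$-core partition is \[ \begin{cases} \frac{w(2w+1)(4w^2+2w+1)}{3} & \text{if } s=4w,\\ \frac{w^2(8w^2-6w+1)}{3} & \text{if } s=4w-1,\\ \frac{w(2w-1)(4w^2-2w+1)}{3} & \text{if } s=4w-2,\\ \frac{(w-1)(2w-1)(4w^2-5w+3)}{3} & \text{if } s=4w-3, \end{cases} \] where in each case $w$ is a positive integer. Moreover, there is a unique self-conjugate $(s,s+1,s+2)$-core partition having this largest size.
   Context: A partition is a finite non-increasing sequence $\lambda=(\lambda_1,\dots,\lambda_\ell)$ of positive integers (the empty partition is allowed); its size is $\sum_i\lambda_i$. The hook length of a cell of the Ferrers diagram of $\lambda$ is the number of cells in its arm plus the number in its leg plus one. A partition is self-conjugate if it equals its conjugate (transpose). A partition is an $a$-core if no cell of its Ferrers diagram has hook length divisible by $a$; it is an $(a_1,\dots,a_n)$-core if it is simultaneously an $a_i$-core for every $i$. *)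

theory Defs
  imports Complex_Main
begin

definition is_partition :: "nat list \<Rightarrow> bool" where
  "is_partition p \<longleftrightarrow> sorted_wrt (\<ge>) p \<and> (\<forall>x\<in>set p. 0 < x)"

definition partition_size :: "nat list \<Rightarrow> nat" where
  "partition_size p = sum_list p"

text \<open>Cells are pairs (row, column), both counted from 0.\<close>

definition ferrers :: "nat list \<Rightarrow> (nat \<times> nat) set" where
  "ferrers p = {(i, j). i < length p \<and> j < p ! i}"

definition arm :: "nat list \<Rightarrow> nat \<times> nat \<Rightarrow> (nat \<times> nat) set" where
  "arm p c = {(i, j) \<in> ferrers p. i = fst c \<and> snd c < j}"

definition leg :: "nat list \<Rightarrow> nat \<times> nat \<Rightarrow> (nat \<times> nat) set" where
  "leg p c = {(i, j) \<in> ferrers p. fst c < i \<and> j = snd c}"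

definition hook_length :: "nat list \<Rightarrow> nat \<times> nat \<Rightarrow> nat" where
  "hook_length p c = card (arm p c) + card (leg p c) + 1"

text \<open>The parts of the conjugate are the column lengths; the number of nonempty columns
  is the first (largest) part, or 0 for the empty partition.\<close>

definition conjugate :: "nat list \<Rightarrow> nat list" where
  "conjugate p =
     map (\<lambda>j. card {i. (i, j) \<in> ferrers p}) [0..<(case p of [] \<Rightarrow> 0 | x # _ \<Rightarrow> x)]"

definition self_conjugate :: "nat list \<Rightarrow> bool" where
  "self_conjugate p \<longleftrightarrow> conjugate p = p"

definition is_core :: "nat \<Rightarrow> nat list \<Rightarrow> bool" where
  "is_core a p \<longleftrightarrow> (\<forall>c\<in>ferrers p. \<not> a dvd hook_length p c)"

definition simultaneous_core :: "nat list \<Rightarrow> nat list \<Rightarrow> bool" where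
  "simultaneous_core as p \<longleftrightarrow> (\<forall>a\<in>set as. is_core a p)"

definition self_conjugate_cores :: "nat list \<Rightarrow> nat list set" where
  "self_conjugate_cores as =
     {p. is_partition p \<and> self_conjugate p \<and> simultaneous_core as p}"

definition is_largest_size :: "nat list set \<Rightarrow> nat \<Rightarrow> bool" where
  "is_largest_size A N \<longleftrightarrow>
     N \<in> partition_size ` A \<and> (\<forall>p\<in>A. partition_size p \<le> N)"

end

theory Submission
  imports Defs "HOL-Library.Infinite_Set"
begin

text \<open>
  Let \<open>X = {r\<^sub>i - i - 1 | i \<ge> 0}\<close>, where \<open>r\<^sub>0, r\<^sub>1, \<dots>\<close> are the parts followed by zeros. Self-conjugacy means
  \<open>x \<in> X \<longleftrightarrow> -1 - x \<notin> X\<close>; the hook of the cell \<open>(i, j)\<close> is then the sum of the \<open>i\<close>-th and \<open>j\<close>-th elements of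
  \<open>X\<close> plus one, being an \<open>a\<close>-core means that \<open>X\<close> is closed under \<open>x \<mapsto> x - a\<close>, and the size is the sum
  of \<open>2x + 1\<close> over the nonnegative \<open>x \<in> X\<close> (the diagonal hooks). Placing \<open>X\<close> on an abacus with
  \<open>m = s + 1\<close> runners, closure under \<open>m\<close> says that runner \<open>i\<close> is filled below a height \<open>h\<^sub>i\<close>, closure
  under \<open>m - 1\<close> and \<open>m + 1\<close> says that neighbouring heights differ by at most one, and symmetry gives
  \<open>h\<^bsub>s-i\<^esub> = - h\<^sub>i\<close> and \<open>h\<^sub>0 \<in> {0, 1}\<close>. So the cores are walks that vanish at \<open>L = \<lfloor>s/2\<rfloor>\<close>, of size
  \<open>\<Sum>i<L. m h\<^sub>i\<^sup>2 - (s - 2i) h\<^sub>i\<close>. If \<open>z\<close> is the first zero of the walk, each summand is maximal when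
  the walk is a tent above the axis before \<open>z\<close> and a tent below the axis between \<open>z\<close> and \<open>L\<close>. The
  resulting polynomial in \<open>z\<close> has its unique maximum at \<open>z = 0\<close> for even \<open>L\<close> and at \<open>z = L\<close> for odd \<open>L\<close>.
\<close>

section \<open>Rows, cells and self-conjugacy\<close>

text \<open>Padding with zeros makes row lengths total, so that cells and transposition can be
  treated without side conditions on the length.\<close>

definition row :: "nat list \<Rightarrow> nat \<Rightarrow> nat" where
  "row p i = (if i < length p then p ! i else 0)"

lemma mem_ferrers_iff: "(i, j) \<in> ferrers p \<longleftrightarrow> j < row p i"
  by (auto simp: ferrers_def row_def)

lemma row_antimono:
  assumes "is_partition p" "i \<le> j"
  shows "row p j \<le> row p i"
proof (cases "i = j \<or> j \<ge> length p")
  case True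
  then show ?thesis by (auto simp: row_def)
next
  case False
  then show ?thesis
    using assms by (auto simp: row_def is_partition_def sorted_wrt_iff_nth_less)
qed

lemma row_pos_iff: "is_partition p \<Longrightarrow> 0 < row p i \<longleftrightarrow> i < length p"
  by (auto simp: row_def is_partition_def)

lemma row_eqD:
  assumes "is_partition p" "is_partition q" "\<And>i. row p i = row q i"
  shows "p = q"
proof -
  have "i < length p \<longleftrightarrow> i < length q" for i
    using assms row_pos_iff by metis
  then have len: "length p = length q"
    by (metis linorder_neqE_nat less_irrefl)
  have "p ! i = q ! i" if "i < length p" for i
    using len that assms(3)[of i] by (simp add: row_def)
  with len show ?thesis by (intro nth_equalityI) auto
qed

lemma down_closed_eq_lessThan_card:
  fixes A :: "nat set"
  assumes "finite A" "\<And>i j. i \<in> A \<Longrightarrow> j \<le> i \<Longrightarrow> j \<in> A"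
  shows "A = {..<card A}"
proof -
  have "\<exists>n. A = {..<n}"
  proof (cases "A = {}")
    case False
    then have "Max A \<in> A" using assms(1) by simp
    then have "{..Max A} \<subseteq> A" using assms(2) by blast
    moreover have "A \<subseteq> {..Max A}" using assms(1) by auto
    ultimately have "A = {..<Suc (Max A)}"
      by (simp add: lessThan_Suc_atMost)
    then show ?thesis by blast
  qed auto
  then show ?thesis by auto
qed

lemma column_eq_lessThan:
  assumes "is_partition p"
  shows "{i. j < row p i} = {..<card {i. j < row p i}}"
proof (rule down_closed_eq_lessThan_card)
  show "finite {i. j < row p i}"
    by (rule finite_subset[of _ "{..<length p}"]) (auto simp: row_def split: if_splits)
next
  fix i k assume "i \<in> {i. j < row p i}" "k \<le> i"
  then show "k \<in> {i. j < row p i}"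
    using row_antimono[OF assms, of k i] by simp
qed

lemma conjugate_eq:
  "conjugate p = map (\<lambda>j. card {i. j < row p i}) [0..<row p 0]"
  by (cases p) (auto simp: conjugate_def mem_ferrers_iff row_def)

text \<open>Part \<open>j\<close> of the conjugate counts the rows longer than \<open>j\<close>;
  these form an initial segment because rows decrease. Equality with \<open>p\<close> therefore says
  that the diagram is invariant under transposition.\<close>

lemma self_conjugate_iff:
  assumes "is_partition p"
  shows "self_conjugate p \<longleftrightarrow> (\<forall>i j. j < row p i \<longleftrightarrow> i < row p j)"
proof
  assume sc: "self_conjugate p"
  then have len: "length p = row p 0"
    by (metis conjugate_eq self_conjugate_def length_map length_upt diff_zero)
  have row_eq: "row p j = card {i. j < row p i}" for j
  proof (cases "j < row p 0")
    case True
    then have "conjugate p ! j = card {i. j < row p i}"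
      by (simp add: conjugate_eq)
    moreover have "conjugate p ! j = row p j"
    proof -
      have "j < length p" using True len by simp
      then have "row p j = p ! j" by (simp add: row_def)
      with sc show ?thesis by (simp add: self_conjugate_def)
    qed
    ultimately show ?thesis by simp
  next
    case False
    then have "{i. j < row p i} = {}"
      using row_antimono[OF assms, of 0] by (auto simp: not_less intro: le_trans)
    moreover have "\<not> j < length p" using False len by simp
    ultimately show ?thesis by (simp add: row_def)
  qed
  show "\<forall>i j. j < row p i \<longleftrightarrow> i < row p j"
  proof (intro allI)
    fix i j
    have "j < row p i \<longleftrightarrow> i \<in> {i. j < row p i}" by simp
    also have "\<dots> \<longleftrightarrow> i < row p j"
      unfolding row_eq[of j] by (subst column_eq_lessThan[OF assms]) simp
    finally show "j < row p i \<longleftrightarrow> i < row p j" .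
  qed
next
  assume sym: "\<forall>i j. j < row p i \<longleftrightarrow> i < row p j"
  then have "i < row p 0 \<longleftrightarrow> i < length p" for i
    using row_pos_iff[OF assms] by blast
  then have len: "row p 0 = length p"
    by (metis linorder_neqE_nat less_irrefl)
  have "card {i. j < row p i} = row p j" for j
    using sym by simp
  then show "self_conjugate p"
    unfolding self_conjugate_def conjugate_eq len
    by (intro nth_equalityI) (auto simp: row_def)
qed

subsection \<open>Maya diagrams of self-conjugate partitions\<close>

definition beta :: "nat list \<Rightarrow> nat \<Rightarrow> int" where
  "beta p i = int (row p i) - int i - 1"

definition maya :: "nat list \<Rightarrow> int set" where
  "maya p = range (beta p)"

text \<open>The reflection has centre -1/2 and thus no fixed integer. Together with boundedness
  above it forces all sufficiently negative integers into \<open>X\<close>.\<close>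

definition symmetric_maya :: "int set \<Rightarrow> bool" where
  "symmetric_maya X \<longleftrightarrow> (\<forall>x. x \<in> X \<longleftrightarrow> - 1 - x \<notin> X) \<and> bdd_above X"

lemma beta_strict_antimono: "is_partition p \<Longrightarrow> i < j \<Longrightarrow> beta p j < beta p i"
  using row_antimono[of p i j] by (simp add: beta_def)

text \<open>The sum equals \<open>(row p i - j - 1) + (row p j - i - 1)\<close>. By symmetry both
  summands are nonnegative or both are at most -1, so the sum is never -1 either.\<close>

lemma beta_add_nonneg_iff:
  assumes "\<forall>i j. j < row p i \<longleftrightarrow> i < row p j"
  shows "j < row p i \<longleftrightarrow> 0 \<le> beta p i + beta p j"
proof (cases "j < row p i")
  case True
  then have "i < row p j" using assms by blast
  with True show ?thesis by (simp add: beta_def)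
next
  case False
  then have "\<not> i < row p j" using assms by blast
  with False show ?thesis by (simp add: beta_def)
qed

lemma symmetric_maya_maya:
  assumes "is_partition p" "self_conjugate p"
  shows "symmetric_maya (maya p)"
proof -
  have sym: "\<forall>i j. j < row p i \<longleftrightarrow> i < row p j"
    using assms self_conjugate_iff by blast
  have disj: "beta p i \<noteq> - 1 - beta p j" for i j
  proof
    assume eq: "beta p i = - 1 - beta p j"
    then have "\<not> j < row p i" using beta_add_nonneg_iff[OF sym, of j i] by simp
    moreover have "\<not> i < row p j" using calculation sym by blast
    ultimately show False using eq by (simp add: beta_def)
  qed
  have cover: "x \<in> maya p" if "- 1 - x \<notin> maya p" for x
  proof -
    have "beta p (length p + nat \<bar>x\<bar>) \<le> - 1 - x"
      by (simp add: beta_def row_def)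
    then have ex: "\<exists>i. beta p i \<le> - 1 - x" by blast
    define i where "i = (LEAST i. beta p i \<le> - 1 - x)"
    have "beta p i \<le> - 1 - x" unfolding i_def by (rule LeastI_ex[OF ex])
    moreover have "beta p i \<noteq> - 1 - x" using that unfolding maya_def by (metis rangeI)
    ultimately have lt: "beta p i < - 1 - x" by simp
    \<comment> \<open>With this \<open>j\<close>, the equation \<open>beta p j = x\<close> means
      \<open>row p j = i\<close>. The choice of \<open>i\<close> as the least index gives the lower
      bound on the row, the inequality at \<open>i\<close> itself the upper one.\<close>
    define j where "j = nat (int i - 1 - x)"
    have j: "int j = int i - 1 - x" using lt by (simp add: beta_def j_def)
    have "\<not> j < row p i" using lt j by (simp add: beta_def)
    then have up: "row p j \<le> i" using sym not_less by blast
    have "i \<le> row p j"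
    proof (cases i)
      case (Suc k)
      then have "\<not> beta p k \<le> - 1 - x"
        using not_less_Least[of k "\<lambda>i. beta p i \<le> - 1 - x"] by (simp add: i_def)
      then have "j < row p k" using j Suc by (simp add: beta_def)
      then show ?thesis using sym Suc by (simp add: Suc_le_eq)
    qed simp
    then have "beta p j = x" using up j by (simp add: beta_def)
    then show ?thesis by (auto simp: maya_def)
  qed
  have "bdd_above (maya p)"
  proof (rule bdd_aboveI)
    fix x assume "x \<in> maya p"
    then obtain i where "x = beta p i" by (auto simp: maya_def)
    then show "x \<le> beta p 0"
      using beta_strict_antimono[OF assms(1), of 0 i] by (cases "i = 0") auto
  qed
  moreover have "- 1 - x \<notin> maya p" if "x \<in> maya p" for x
    using that disj unfolding maya_def by (metis rangeE)
  ultimately show ?thesis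
    using cover unfolding symmetric_maya_def by blast
qed

text \<open>By symmetry column \<open>j\<close> is as long as row \<open>j\<close>, so the arm has
  \<open>row p i - j - 1\<close> cells and the leg \<open>row p j - i - 1\<close>.\<close>

lemma hook_length_eq:
  assumes sym: "\<forall>i j. j < row p i \<longleftrightarrow> i < row p j" and cell: "j < row p i"
  shows "int (hook_length p (i, j)) = beta p i + beta p j + 1"
proof -
  have "arm p (i, j) = Pair i ` {j<..<row p i}"
    by (auto simp: arm_def mem_ferrers_iff)
  then have arm: "card (arm p (i, j)) = row p i - Suc j"
    by (simp add: card_image inj_on_def)
  have "leg p (i, j) = (\<lambda>k. (k, j)) ` {i<..<row p j}"
    using sym by (auto simp: leg_def mem_ferrers_iff)
  then have leg: "card (leg p (i, j)) = row p j - Suc i"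
    by (simp add: card_image inj_on_def)
  have "i < row p j" using sym cell by blast
  then show ?thesis
    using cell arm leg by (simp add: hook_length_def beta_def of_nat_diff)
qed

text \<open>If \<open>x\<close> is in the diagram but \<open>x - a\<close> is not, symmetry puts
  \<open>-1 - (x - a)\<close> into it, and these two elements give a cell with hook length exactly
  \<open>a\<close>. Conversely, a hook of length \<open>a * n\<close> at \<open>(i, j)\<close> lets
  \<open>n\<close> steps down from \<open>beta p i\<close> reach \<open>-1 - beta p j\<close>, which
  symmetry excludes.\<close>

lemma is_core_iff:
  assumes p: "is_partition p" "self_conjugate p" and "0 < a"
  shows "is_core a p \<longleftrightarrow> (\<forall>x\<in>maya p. x - int a \<in> maya p)"
proof
  have sym: "\<forall>i j. j < row p i \<longleftrightarrow> i < row p j"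
    using p self_conjugate_iff by blast
  have ms: "x \<in> maya p \<longleftrightarrow> - 1 - x \<notin> maya p" for x
    using symmetric_maya_maya[OF p] unfolding symmetric_maya_def by blast
  {
    assume core: "is_core a p"
    show "\<forall>x\<in>maya p. x - int a \<in> maya p"
    proof (rule ballI, rule ccontr)
      fix x assume "x \<in> maya p" "x - int a \<notin> maya p"
      moreover have "- 1 - (x - int a) \<in> maya p"
        using calculation ms[of "x - int a"] by blast
      ultimately obtain i j where ij: "x = beta p i" "- 1 - (x - int a) = beta p j"
        by (auto simp: maya_def)
      then have cell: "j < row p i"
        using beta_add_nonneg_iff[OF sym] \<open>0 < a\<close> by simp
      then have "hook_length p (i, j) = a"
        using hook_length_eq[OF sym cell] ij by simp
      then show False
        using core cell unfolding is_core_def by (metis mem_ferrers_iff dvd_refl)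
    qed
  next
    assume closed: "\<forall>x\<in>maya p. x - int a \<in> maya p"
    have iter: "x - int n * int a \<in> maya p" if "x \<in> maya p" for x n
    proof (induction n)
      case (Suc n)
      then have "x - int n * int a - int a \<in> maya p" using closed by blast
      then show ?case by (simp add: algebra_simps)
    qed (use that in simp)
    show "is_core a p"
      unfolding is_core_def
    proof (clarify)
      fix i j assume "(i, j) \<in> ferrers p" "a dvd hook_length p (i, j)"
      then obtain n where cell: "j < row p i" and n: "hook_length p (i, j) = a * n"
        by (auto simp: mem_ferrers_iff)
      have "beta p i - int n * int a = - 1 - beta p j"
        using hook_length_eq[OF sym cell] n by (simp add: algebra_simps)
      then have "- 1 - beta p j \<in> maya p"
        using iter[of "beta p i" n] by (simp add: maya_def)
      moreover have "beta p j \<in> maya p" by (simp add: maya_def)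
      ultimately show False using ms by blast
    qed
  }
qed

text \<open>Cells are grouped by the smaller of their two coordinates, that is, by the diagonal hook
  containing them.\<close>

lemma partition_size_eq_sum_maya:
  assumes p: "is_partition p" "self_conjugate p"
  shows "int (partition_size p) = (\<Sum>x\<in>{x\<in>maya p. 0 \<le> x}. 2 * x + 1)"
proof -
  have sym: "\<forall>i j. j < row p i \<longleftrightarrow> i < row p j"
    using p self_conjugate_iff by blast
  define D where "D = {k. k < row p k}"
  define H where "H k = {c \<in> ferrers p. min (fst c) (snd c) = k}" for k
  have ferrers: "ferrers p = (SIGMA i:{..<length p}. {..<row p i})"
    by (auto simp: ferrers_def row_def)
  have finF: "finite (ferrers p)" unfolding ferrers by auto
  have size: "partition_size p = card (ferrers p)"
    unfolding ferrers partition_size_def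
    by (subst card_SigmaI) (auto simp: row_def sum_list_sum_nth lessThan_atLeast0)
  have finD: "finite D"
    unfolding D_def
    by (rule finite_subset[of _ "{..<length p}"]) (auto simp: row_def split: if_splits)
  have "ferrers p = (\<Union>k\<in>D. H k)"
  proof -
    have "min i j < row p (min i j)" if "j < row p i" for i j
    proof -
      have "row p i \<le> row p (min i j)" "row p j \<le> row p (min i j)"
        by (auto intro: row_antimono[OF p(1)])
      moreover have "i < row p j" using sym that by blast
      ultimately show ?thesis using that by linarith
    qed
    then show ?thesis by (auto simp: H_def D_def mem_ferrers_iff)
  qed
  then have "card (ferrers p) = (\<Sum>k\<in>D. card (H k))"
    using finD finF by (subst card_UN_disjoint[symmetric]) (auto simp: H_def)
  moreover have "int (card (H k)) = 2 * beta p k + 1" if "k \<in> D" for k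
  proof -
    have k: "k < row p k" using that by (simp add: D_def)
    have "H k = Pair k ` {k..<row p k} \<union> (\<lambda>i. (i, k)) ` {k<..<row p k}"
      using sym by (auto simp: H_def mem_ferrers_iff min_def split: if_splits)
    moreover have "card (Pair k ` {k..<row p k} \<union> (\<lambda>i. (i, k)) ` {k<..<row p k})
        = (row p k - k) + (row p k - Suc k)"
      by (subst card_Un_disjoint) (auto simp: card_image inj_on_def)
    ultimately show ?thesis using k by (simp add: beta_def of_nat_diff)
  qed
  ultimately have "int (partition_size p) = (\<Sum>k\<in>D. 2 * beta p k + 1)"
    by (simp add: size)
  also have "\<dots> = (\<Sum>x\<in>beta p ` D. 2 * x + 1)"
  proof (subst sum.reindex)
    show "inj_on (beta p) D"
      using beta_strict_antimono[OF p(1)] by (intro linorder_inj_onI) force+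
  qed simp
  also have "beta p ` D = {x\<in>maya p. 0 \<le> x}"
    by (auto simp: D_def maya_def beta_def)
  finally show ?thesis .
qed

section \<open>Recovering a partition from its Maya diagram\<close>

lemma strict_antimono_le:
  fixes b :: "nat \<Rightarrow> int"
  assumes "\<And>i j. i < j \<Longrightarrow> b j < b i" "i \<le> j"
  shows "b j + int (j - i) \<le> b i"
  using assms(2)
proof (induction j rule: dec_induct)
  case (step n)
  then show ?case using assms(1)[of n "Suc n"] by (simp add: Suc_diff_le)
qed simp

text \<open>Entry \<open>b i\<close> is the element of the range with exactly \<open>i\<close>
  larger ones. The right-hand side mentions only the range, so a strictly decreasing enumeration is
  determined by its range.\<close>

lemma le_strict_antimono_iff_card:
  fixes b :: "nat \<Rightarrow> int"
  assumes b: "\<And>i j. i < j \<Longrightarrow> b j < b i"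
  shows "x \<le> b i \<longleftrightarrow> i < card {y \<in> range b. x \<le> y}"
proof -
  define A where "A = {i. x \<le> b i}"
  have "i \<le> nat (b 0 - x)" if "x \<le> b i" for i
    using strict_antimono_le[of b 0 i] b that by simp
  then have "A \<subseteq> {..nat (b 0 - x)}" by (auto simp: A_def)
  then have fin: "finite A" by (rule finite_subset) simp
  have "A = {..<card A}"
  proof (rule down_closed_eq_lessThan_card[OF fin])
    fix i j assume "i \<in> A" "j \<le> i"
    moreover have "b i + int (i - j) \<le> b j"
      using b \<open>j \<le> i\<close> by (rule strict_antimono_le)
    ultimately show "j \<in> A" by (simp add: A_def)
  qed
  moreover have "{y \<in> range b. x \<le> y} = b ` A" by (auto simp: A_def)
  moreover have "inj_on b A"
    using b by (intro linorder_inj_onI) force+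
  ultimately show ?thesis
    by (metis A_def card_image lessThan_iff mem_Collect_eq)
qed

lemma maya_inject:
  assumes "is_partition p" "is_partition q" "maya p = maya q"
  shows "p = q"
proof (rule row_eqD[OF assms(1,2)])
  fix i
  have "x \<le> beta p i \<longleftrightarrow> x \<le> beta q i" for x
    using le_strict_antimono_iff_card[of "beta p" x i] le_strict_antimono_iff_card[of "beta q" x i]
      beta_strict_antimono assms unfolding maya_def by presburger
  then have "beta p i = beta q i" by (meson order_antisym order_refl)
  then show "row p i = row q i" by (simp add: beta_def)
qed

lemma symmetric_mayaD: "symmetric_maya X \<Longrightarrow> x \<in> X \<longleftrightarrow> - 1 - x \<notin> X"
  unfolding symmetric_maya_def by blast

lemma finite_symmetric_maya_tail:
  assumes "symmetric_maya X"
  shows "finite {y \<in> X. x \<le> y}"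
proof -
  obtain M where "y \<le> M" if "y \<in> X" for y
    using assms unfolding symmetric_maya_def bdd_above_def by blast
  then have "{y \<in> X. x \<le> y} \<subseteq> {x..M}" by auto
  then show ?thesis by (rule finite_subset) simp
qed

lemma card_maya_tail_step:
  assumes "symmetric_maya X"
  shows "card {y \<in> X. x \<le> y} = card {y \<in> X. x + 1 \<le> y} + (if x \<in> X then 1 else 0)"
proof (cases "x \<in> X")
  case True
  then have "{y \<in> X. x \<le> y} = insert x {y \<in> X. x + 1 \<le> y}" by auto
  then show ?thesis using True finite_symmetric_maya_tail[OF assms] by simp
next
  case False
  then have "{y \<in> X. x \<le> y} = {y \<in> X. x + 1 \<le> y}"
    by (metis (no_types, lifting) add1_zle_eq order_le_less)
  then show ?thesis using False by simp
qed

text \<open>For nonnegative \<open>x\<close>, the integers from \<open>-x\<close> to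
  \<open>x - 1\<close> split into \<open>x\<close> pairs exchanged by the reflection, and
  \<open>X\<close> contains exactly one element of each pair. The case of negative \<open>x\<close>
  is the same identity read backwards.\<close>

lemma card_maya_tail_reflect:
  assumes "symmetric_maya X"
  shows "int (card {y \<in> X. - x \<le> y}) = int (card {y \<in> X. x \<le> y}) + x"
proof -
  have nonneg: "int (card {y \<in> X. - int n \<le> y}) = int (card {y \<in> X. int n \<le> y}) + int n" for n
  proof (induction n)
    case (Suc n)
    have eq: "- 1 - int n = - int (Suc n)" "- int (Suc n) + 1 = - int n" "int n + 1 = int (Suc n)"
      by simp_all
    show ?case
      using Suc symmetric_mayaD[OF assms, of "int n"] card_maya_tail_step[OF assms, of "int n"]
        card_maya_tail_step[OF assms, of "- int (Suc n)"]
      unfolding eq by (cases "int n \<in> X") (simp_all only: if_True if_False, simp_all)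
  qed simp
  show ?thesis
    using nonneg[of "nat x"] nonneg[of "nat (- x)"] by (cases "x \<ge> 0") auto
qed

text \<open>Reflecting at an upper bound \<open>M\<close> turns \<open>X\<close> into an infinite
  set of naturals, whose increasing enumeration is reflected back.\<close>

lemma strict_antimono_enumeration:
  fixes X :: "int set"
  assumes "bdd_above X" "\<not> bdd_below X"
  obtains b :: "nat \<Rightarrow> int" where "monotone (<) (>) b" "range b = X"
proof -
  obtain M where M: "y \<le> M" if "y \<in> X" for y
    using assms(1) unfolding bdd_above_def by blast
  define Y where "Y = {n. M - int n \<in> X}"
  have "\<exists>n>m. n \<in> Y" for m
  proof -
    obtain y where "y \<in> X" "y < M - int m"
      using assms(2) unfolding bdd_below_def by (meson not_le)
    moreover from this have "M - int (nat (M - y)) = y" by simp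
    ultimately show ?thesis
      unfolding Y_def by (intro exI[of _ "nat (M - y)"]) auto
  qed
  then have inf: "infinite Y" by (simp add: infinite_nat_iff_unbounded)
  define b where "b i = M - int (enumerate Y i)" for i
  have "monotone (<) (>) b"
    using enumerate_mono[OF _ inf] by (simp add: b_def monotone_def)
  moreover have "range b = X"
  proof -
    have "range b = (\<lambda>n. M - int n) ` range (enumerate Y)"
      by (simp add: b_def image_image)
    also have "\<dots> = (\<lambda>n. M - int n) ` Y"
      by (simp only: range_enumerate[OF inf])
    also have "\<dots> = X"
    proof
      show "X \<subseteq> (\<lambda>n. M - int n) ` Y"
      proof
        fix y assume "y \<in> X"
        with M[of y] show "y \<in> (\<lambda>n. M - int n) ` Y"
          by (intro image_eqI[of _ _ "nat (M - y)"]) (auto simp: Y_def)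
      qed
    qed (auto simp: Y_def)
    finally show ?thesis .
  qed
  ultimately show ?thesis by (rule that)
qed

lemma ex_self_conjugate_maya:
  assumes X: "symmetric_maya X"
  shows "\<exists>p. is_partition p \<and> self_conjugate p \<and> maya p = X"
proof -
  have below: "\<not> bdd_below X"
  proof
    assume "bdd_below X"
    then obtain m where m: "m \<le> y" if "y \<in> X" for y
      unfolding bdd_below_def by blast
    obtain M where M: "y \<le> M" if "y \<in> X" for y
      using X unfolding symmetric_maya_def bdd_above_def by blast
    \<comment> \<open>Chosen so that \<open>y\<close> exceeds \<open>M\<close> while its reflection
      lies below \<open>m\<close>; symmetry requires one of the two to be in
      \<open>X\<close>.\<close>
    define y where "y = max (M + 1) (- m)"
    have "y \<in> X \<or> - 1 - y \<in> X" using symmetric_mayaD[OF X] by blast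
    then show False using M[of y] m[of "- 1 - y"] by (auto simp: y_def)
  qed
  have above: "bdd_above X" using X by (simp only: symmetric_maya_def)
  obtain b :: "nat \<Rightarrow> int"
    where mono_b: "monotone (<) (>) b" and range: "range b = X"
    by (rule strict_antimono_enumeration[OF above below])
  have b: "b j < b i" if "i < j" for i j
    using mono_b that by (rule monotoneD)
  have count: "x \<le> b i \<longleftrightarrow> i < card {y \<in> X. x \<le> y}" for x i
    using le_strict_antimono_iff_card[of b x i] b unfolding range by blast
  have "card {y \<in> X. b i \<le> y} = Suc i" for i
  proof -
    have "b i \<le> b k \<longleftrightarrow> k \<le> i" for k
      using b[of i k] b[of k i] by (cases i k rule: linorder_cases) auto
    then have "k < card {y \<in> X. b i \<le> y} \<longleftrightarrow> k < Suc i" for k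
      by (simp only: count[symmetric] less_Suc_eq_le)
    then show ?thesis by (metis linorder_neqE_nat less_irrefl)
  qed
  \<comment> \<open>The row lengths have to be \<open>b i + i + 1\<close>. Obtaining them as
    cardinalities shows that they are nonnegative and yields a cell criterion symmetric in
    \<open>i\<close> and \<open>j\<close>.\<close>
  moreover define r where "r i = card {y \<in> X. - b i \<le> y}" for i
  ultimately have r: "int (r i) = b i + int i + 1" for i
    using card_maya_tail_reflect[OF X, of "b i"] by simp
  have r_iff: "j < r i \<longleftrightarrow> 0 \<le> b i + b j" for i j
    using count[of "- b i" j] by (auto simp: r_def)
  then have sym: "j < r i \<longleftrightarrow> i < r j" for i j
    by (simp add: add.commute)
  have mono: "r j \<le> r i" if "i \<le> j" for i j
    using strict_antimono_le[of b i j, OF b that] r[of i] r[of j] that by simp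
  define p where "p = map r [0..<r 0]"
  have part: "is_partition p"
    unfolding p_def is_partition_def
    using mono sym by (auto simp: sorted_wrt_iff_nth_less)
  have row: "row p i = r i" for i
    using sym[of 0 i] by (auto simp: row_def p_def)
  have "self_conjugate p"
    using self_conjugate_iff[OF part] sym row by simp
  moreover have "beta p = b"
    using r row by (auto simp: beta_def)
  ultimately show ?thesis
    using part range unfolding maya_def by blast
qed

subsection \<open>Abaci and walks\<close>

text \<open>The condition on \<open>h 0\<close> comes from the wrap-around: subtracting
  \<open>s\<close> takes runner \<open>s\<close> to runner 0 in the same row, and subtracting
  \<open>s + 2\<close> takes runner 0 to runner \<open>s\<close> two rows down. Hence
  \<open>h s \<le> h 0 \<le> h s + 2\<close>, where \<open>h s = - h 0\<close>.\<close>

definition walk :: "nat \<Rightarrow> (nat \<Rightarrow> int) \<Rightarrow> bool" where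
  "walk s h \<longleftrightarrow> h 0 \<in> {0, 1} \<and> (\<forall>i<s. \<bar>h (Suc i) - h i\<bar> \<le> 1) \<and> (\<forall>i\<le>s. h (s - i) = - h i)"

text \<open>On runner \<open>i\<close> of the abacus with \<open>s + 1\<close> runners the beads sit in all rows below \<open>h i\<close>.\<close>

definition abacus :: "nat \<Rightarrow> (nat \<Rightarrow> int) \<Rightarrow> int set" where
  "abacus s h = {x. x div (int s + 1) < h (nat (x mod (int s + 1)))}"

lemma mem_abacus_iff:
  assumes "i \<le> s"
  shows "int i + (int s + 1) * k \<in> abacus s h \<longleftrightarrow> k < h i"
proof -
  have "(int i + (int s + 1) * k) div (int s + 1) = k"
    using assms by simp
  moreover have "(int i + (int s + 1) * k) mod (int s + 1) = int i"
    using assms by simp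
  ultimately show ?thesis by (simp add: abacus_def)
qed

lemma abacus_coordinates:
  obtains i k where "i \<le> s" "x = int i + (int s + 1) * k"
proof
  show "nat (x mod (int s + 1)) \<le> s"
    using pos_mod_bound[of "int s + 1" x] by linarith
  show "x = int (nat (x mod (int s + 1))) + (int s + 1) * (x div (int s + 1))"
    by simp
qed

lemma abacus_coordinates_unique:
  assumes "i \<le> s" "i' \<le> s" "int i + (int s + 1) * k = int i' + (int s + 1) * k'"
  shows "i = i' \<and> k = k'"
proof -
  have "(int i + (int s + 1) * k) mod (int s + 1) = int i"
    "(int i' + (int s + 1) * k') mod (int s + 1) = int i'"
    using assms(1,2) by simp_all
  then have "i = i'" using assms(3) by simp
  then show ?thesis using assms(3) by simp
qed

lemma abacus_cong:
  assumes "\<And>i. i \<le> s \<Longrightarrow> h i = h' i"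
  shows "abacus s h = abacus s h'"
proof (rule set_eqI)
  fix x
  obtain i k where "i \<le> s" "x = int i + (int s + 1) * k"
    by (rule abacus_coordinates)
  then show "x \<in> abacus s h \<longleftrightarrow> x \<in> abacus s h'"
    using assms by (simp only: mem_abacus_iff)
qed

lemma walkD:
  assumes "walk s h"
  shows "h 0 = 0 \<or> h 0 = 1" "i < s \<Longrightarrow> \<bar>h (Suc i) - h i\<bar> \<le> 1" "i \<le> s \<Longrightarrow> h (s - i) = - h i"
  using assms unfolding walk_def by auto

text \<open>The reflection sends row \<open>k\<close> of runner \<open>i\<close> to row
  \<open>-k - 1\<close> of runner \<open>s - i\<close>, so the antisymmetry of \<open>h\<close> is
  exactly the symmetry of the abacus.\<close>

lemma symmetric_maya_abacus:
  assumes "walk s h"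
  shows "symmetric_maya (abacus s h)"
proof -
  have "x \<in> abacus s h \<longleftrightarrow> - 1 - x \<notin> abacus s h" for x
  proof -
    obtain i k where i: "i \<le> s" and x: "x = int i + (int s + 1) * k"
      by (rule abacus_coordinates)
    have "- 1 - x = int (s - i) + (int s + 1) * (- k - 1)"
      using i x by (simp add: of_nat_diff algebra_simps)
    then have "- 1 - x \<in> abacus s h \<longleftrightarrow> - k - 1 < h (s - i)"
      by (simp only: mem_abacus_iff diff_le_self)
    moreover have "x \<in> abacus s h \<longleftrightarrow> k < h i"
      using i x by (simp only: mem_abacus_iff)
    ultimately show ?thesis using walkD(3)[OF assms i] by linarith
  qed
  moreover have "bdd_above (abacus s h)"
  proof (rule bdd_aboveI)
    fix x assume "x \<in> abacus s h"
    moreover obtain i k where i: "i \<le> s" and x: "x = int i + (int s + 1) * k"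
      by (rule abacus_coordinates)
    ultimately have "k < h i" by (simp only: mem_abacus_iff)
    moreover have "h i \<le> Max (h ` {..s})" using i by simp
    ultimately have "(int s + 1) * k \<le> (int s + 1) * Max (h ` {..s})"
      by (intro mult_left_mono) auto
    then show "x \<le> int s + (int s + 1) * Max (h ` {..s})"
      unfolding x using i by linarith
  qed
  ultimately show ?thesis unfolding symmetric_maya_def by blast
qed

text \<open>Subtracting \<open>s + 1\<close> goes down one row on the same runner; \<open>s\<close>
  and \<open>s + 2\<close> lead to the next and the previous runner, also one row down, except at
  the wrap-around between runners \<open>s\<close> and 0.\<close>

lemma abacus_closed:
  assumes "walk s h" "x \<in> abacus s h" "a \<in> {s, s + 1, s + 2}"
  shows "x - int a \<in> abacus s h"
proof -
  obtain i k where i: "i \<le> s" and x: "x = int i + (int s + 1) * k"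
    by (rule abacus_coordinates)
  have k: "k < h i" using assms(2) i x by (simp only: mem_abacus_iff)
  consider "a = s + 1" | "a = s" "i < s" | "a = s" "i = s" | "a = s + 2" "i = 0"
    | j where "a = s + 2" "i = Suc j"
    using assms(3) i by (cases i) fastforce+
  then show ?thesis
  proof cases
    case 1
    then have eq: "x - int a = int i + (int s + 1) * (k - 1)"
      using x by (simp add: algebra_simps)
    show ?thesis unfolding eq mem_abacus_iff[OF i] using k by simp
  next
    case 2
    then have eq: "x - int a = int (Suc i) + (int s + 1) * (k - 1)"
      using x by (simp add: algebra_simps)
    have "Suc i \<le> s" using 2 by simp
    then show ?thesis
      unfolding eq using mem_abacus_iff[of "Suc i" s "k - 1" h] k walkD(2)[OF assms(1) 2(2)]
      by linarith
  next
    case 3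
    then have eq: "x - int a = int 0 + (int s + 1) * k"
      using x by simp
    show ?thesis
      unfolding eq using mem_abacus_iff[of 0 s k h] k 3 walkD(1)[OF assms(1)] walkD(3)[OF assms(1), of 0] by auto
  next
    case 4
    then have eq: "x - int a = int s + (int s + 1) * (k - 2)"
      using x by (simp add: algebra_simps)
    show ?thesis
      unfolding eq using mem_abacus_iff[of s s "k - 2" h] k 4 walkD(1)[OF assms(1)] walkD(3)[OF assms(1), of 0] by auto
  next
    case 5
    then have eq: "x - int a = int j + (int s + 1) * (k - 1)"
      using x by (simp add: algebra_simps)
    have "j < s" using 5 i by simp
    then show ?thesis
      unfolding eq using mem_abacus_iff[of j s "k - 1" h] k 5 walkD(2)[OF assms(1), of j] by auto
  qed
qed

lemma down_closed_int_eq_lessThan: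
  fixes P :: "int \<Rightarrow> bool"
  assumes down: "\<And>k. P k \<Longrightarrow> P (k - 1)" and "P a" "\<not> P b"
  shows "\<exists>c. \<forall>k. P k \<longleftrightarrow> k < c"
proof -
  have down': "P (k - int n)" if "P k" for k n
  proof (induction n)
    case (Suc n)
    then have "P (k - int n - 1)" by (rule down)
    then show ?case by (simp add: algebra_simps)
  qed (use that in simp)
  have mono: "P l" if "P k" "l \<le> k" for k l
    using down'[OF that(1), of "nat (k - l)"] that(2) by simp
  have "b \<le> a + int (nat (b - a))" by linarith
  then have "\<not> P (a + int (nat (b - a)))" using mono assms(3) by blast
  then have ex: "\<exists>n. \<not> P (a + int n)" by blast
  define n where "n = (LEAST n. \<not> P (a + int n))"
  have n: "\<not> P (a + int n)" unfolding n_def by (rule LeastI_ex[OF ex])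
  have "n \<noteq> 0" using n assms(2) by (cases n) auto
  then obtain l where l: "n = Suc l" by (cases n) auto
  then have "P (a + int l)"
    using not_less_Least[of l "\<lambda>n. \<not> P (a + int n)"] by (simp add: n_def)
  then have "P k \<longleftrightarrow> k < a + int n" for k
    using n mono[of k "a + int n"] mono[of "a + int l" k] l by force
  then show ?thesis by blast
qed

lemma ex_walk_of_closed_maya:
  assumes X: "symmetric_maya X"
    and closed: "\<And>x a. x \<in> X \<Longrightarrow> a \<in> {s, s + 1, s + 2} \<Longrightarrow> x - int a \<in> X"
  shows "\<exists>h. walk s h \<and> X = abacus s h"
proof -
  let ?m = "int s + 1"
  obtain M where M: "y \<le> M" if "y \<in> X" for y
    using X unfolding symmetric_maya_def bdd_above_def by blast
  have "\<exists>c. \<forall>k. int i + ?m * k \<in> X \<longleftrightarrow> k < c" for i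
  proof (rule down_closed_int_eq_lessThan)
    fix k assume "int i + ?m * k \<in> X"
    then have "int i + ?m * k - int (s + 1) \<in> X" using closed by blast
    then show "int i + ?m * (k - 1) \<in> X" by (simp add: algebra_simps)
  next
    \<comment> \<open>Row \<open>t\<close> of the runner lies above the bound \<open>M\<close>, and
      so does the reflection of row \<open>-t - 1\<close>; the summand \<open>int i\<close> serves
      the latter. Hence the runner is neither empty nor full.\<close>
    define t where "t = \<bar>M\<bar> + 1 + int i"
    have big: "t \<le> ?m * t"
      by (rule mult_le_cancel_right1[THEN iffD2]) (auto simp: t_def)
    show "int i + ?m * t \<notin> X"
      using M[of "int i + ?m * t"] big by (auto simp: t_def)
    have eq: "- 1 - (int i + ?m * (- t - 1)) = ?m * t + int s - int i"
      by (simp add: algebra_simps)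
    have "M < ?m * t + int s - int i"
      using big unfolding t_def by linarith
    then have "- 1 - (int i + ?m * (- t - 1)) \<notin> X"
      unfolding eq using M by force
    then show "int i + ?m * (- t - 1) \<in> X"
      using symmetric_mayaD[OF X] by blast
  qed
  then obtain h where h: "int i + ?m * k \<in> X \<longleftrightarrow> k < h i" for i k by metis
  have move: "k < h j"
    if "l < h i" "a \<in> {s, s + 1, s + 2}" "int i + ?m * l - int a = int j + ?m * k" for i j k l a
    using closed[of "int i + ?m * l" a] that h by metis
  have refl: "h (s - i) = - h i" if "i \<le> s" for i
  proof -
    have "k < h i \<longleftrightarrow> \<not> - k - 1 < h (s - i)" for k
    proof -
      have "- 1 - (int i + ?m * k) = int (s - i) + ?m * (- k - 1)"
        using that by (simp add: of_nat_diff algebra_simps)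
      then show ?thesis
        using symmetric_mayaD[OF X, of "int i + ?m * k"] h[of i k] h[of "s - i" "- k - 1"] by simp
    qed
    from this[of "h i"] this[of "h i - 1"] show ?thesis by linarith
  qed
  \<comment> \<open>Applied to the topmost bead of a runner, in row \<open>h i - 1\<close>, the
    moves become inequalities between heights.\<close>
  have "\<bar>h (Suc i) - h i\<bar> \<le> 1" for i
    using move[of "h i - 1" i s "Suc i" "h i - 2"]
      move[of "h (Suc i) - 1" "Suc i" "s + 2" i "h (Suc i) - 2"]
    by (simp add: algebra_simps)
  moreover have "h 0 \<in> {0, 1}"
    using move[of "h s - 1" s s 0 "h s - 1"] move[of "h 0 - 1" 0 "s + 2" s "h 0 - 3"] refl[of 0]
    by (simp add: algebra_simps) linarith
  ultimately have "walk s h" using refl by (simp add: walk_def)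
  moreover have "X = abacus s h"
  proof (rule set_eqI)
    fix x
    obtain i k where "i \<le> s" "x = int i + ?m * k"
      by (rule abacus_coordinates)
    then show "x \<in> X \<longleftrightarrow> x \<in> abacus s h"
      using h by (simp only: mem_abacus_iff)
  qed
  ultimately show ?thesis by blast
qed

section \<open>The size of a core as a sum along its walk\<close>

text \<open>For \<open>c > 0\<close> this is the contribution of runner \<open>i\<close> with height
  \<open>c\<close>. The formula is unchanged under replacing \<open>i\<close> by
  \<open>s - i\<close> and \<open>c\<close> by \<open>-c\<close>, so for \<open>c < 0\<close> it is
  the contribution of the mirror runner.\<close>

definition walk_weight :: "nat \<Rightarrow> nat \<Rightarrow> int \<Rightarrow> int" where
  "walk_weight s i c = (int s + 1) * c\<^sup>2 - (int s - 2 * int i) * c"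

lemma sum_runner:
  "(\<Sum>k\<in>{0..<c}. 2 * (int i + (int s + 1) * k) + 1) = (if 0 < c then walk_weight s i c else 0)"
proof -
  have "(\<Sum>k\<in>{0..<int n}. 2 * (int i + (int s + 1) * k) + 1) = walk_weight s i (int n)" for n
  proof (induction n)
    case (Suc n)
    have "{0..<int (Suc n)} = insert (int n) {0..<int n}" by auto
    then have "(\<Sum>k\<in>{0..<int (Suc n)}. 2 * (int i + (int s + 1) * k) + 1)
        = 2 * (int i + (int s + 1) * int n) + 1 + walk_weight s i (int n)"
      using Suc by simp
    then show ?case by (simp add: walk_weight_def power2_eq_square algebra_simps)
  qed (simp add: walk_weight_def)
  from this[of "nat c"] show ?thesis by (cases "0 < c") auto
qed

text \<open>For even \<open>s\<close> the middle runner is its own mirror image. For odd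
  \<open>s\<close> the two middle heights are opposite and differ by at most one, so both
  vanish.\<close>

lemma walk_mid_eq_0:
  assumes "walk s h" "i \<in> {s div 2..s - s div 2}"
  shows "h i = 0"
proof -
  have 0: "h (s div 2) = 0"
  proof (cases "even s")
    case True
    then have "s - s div 2 = s div 2" by presburger
    then show ?thesis using walkD(3)[OF assms(1), of "s div 2"] by simp
  next
    case False
    then have "s - s div 2 = Suc (s div 2)" "s div 2 < s" by presburger+
    then show ?thesis using walkD(2,3)[OF assms(1), of "s div 2"] by simp
  qed
  have "i = s div 2 \<or> i = s - s div 2"
    using assms(2) by auto
  then show ?thesis using 0 walkD(3)[OF assms(1), of "s div 2"] by auto
qed

lemma sum_abacus:
  assumes "walk s h"
  shows "(\<Sum>x\<in>{x\<in>abacus s h. 0 \<le> x}. 2 * x + 1) = (\<Sum>i<s div 2. walk_weight s i (h i))"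
proof -
  let ?L = "s div 2"
  define F where "F i = (if 0 < h i then walk_weight s i (h i) else 0)" for i
  define e where "e = (\<lambda>(i, k). int i + (int s + 1) * k)"
  define S where "S = (SIGMA i:{..s}. {0..<h i})"
  have inj: "inj_on e S"
  proof (rule inj_onI)
    fix c d assume cd: "c \<in> S" "d \<in> S" "e c = e d"
    obtain i k i' k' where "c = (i, k)" "d = (i', k')" by (metis surj_pair)
    with cd show "c = d"
      using abacus_coordinates_unique[of i s i' k k'] by (simp add: S_def e_def)
  qed
  have "{x\<in>abacus s h. 0 \<le> x} = e ` S"
  proof (rule set_eqI)
    fix x
    obtain i k where i: "i \<le> s" and x: "x = int i + (int s + 1) * k"
      by (rule abacus_coordinates)
    have "x \<in> abacus s h \<longleftrightarrow> k < h i" using i x by (simp only: mem_abacus_iff)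
    moreover have "0 \<le> x \<longleftrightarrow> 0 \<le> k"
    proof
      assume "0 \<le> x"
      then have "0 \<le> x div (int s + 1)" by (simp add: pos_imp_zdiv_nonneg_iff)
      then show "0 \<le> k" using i x by simp
    qed (use x in simp)
    moreover have "x \<in> e ` S \<longleftrightarrow> (i, k) \<in> S"
    proof
      assume "x \<in> e ` S"
      then obtain i' k' where S: "(i', k') \<in> S" and x': "x = int i' + (int s + 1) * k'"
        by (auto simp: e_def)
      then have "i' \<le> s" by (simp add: S_def)
      then have "i = i' \<and> k = k'"
        using x x' i by (intro abacus_coordinates_unique) auto
      then show "(i, k) \<in> S" using S by simp
    next
      assume "(i, k) \<in> S"
      then show "x \<in> e ` S" using x by (intro image_eqI[of _ _ "(i, k)"]) (auto simp: e_def)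
    qed
    ultimately show "x \<in> {x\<in>abacus s h. 0 \<le> x} \<longleftrightarrow> x \<in> e ` S"
      using i by (auto simp: S_def)
  qed
  then have "(\<Sum>x\<in>{x\<in>abacus s h. 0 \<le> x}. 2 * x + 1) = (\<Sum>c\<in>S. 2 * e c + 1)"
    by (simp add: sum.reindex[OF inj])
  also have "\<dots> = (\<Sum>i\<le>s. \<Sum>k\<in>{0..<h i}. 2 * (int i + (int s + 1) * k) + 1)"
    unfolding S_def by (subst sum.Sigma) (auto simp: e_def intro!: sum.cong)
  also have "\<dots> = (\<Sum>i\<le>s. F i)"
    unfolding F_def sum_runner ..
  also have "\<dots> = (\<Sum>i\<in>{..<?L} \<union> {s - ?L<..s}. F i)"
  proof (rule sum.mono_neutral_right)
    show "\<forall>i\<in>{..s} - ({..<?L} \<union> {s - ?L<..s}). F i = 0"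
      using walk_mid_eq_0[OF assms] by (auto simp: F_def)
  qed auto
  also have "\<dots> = (\<Sum>i<?L. F i) + (\<Sum>i\<in>{s - ?L<..s}. F i)"
    by (rule sum.union_disjoint) auto
  also have "(\<Sum>i\<in>{s - ?L<..s}. F i) = (\<Sum>i<?L. F (s - i))"
    by (rule sum.reindex_bij_witness[of _ "\<lambda>i. s - i" "\<lambda>i. s - i"]) auto
  \<comment> \<open>At most one of \<open>h i\<close> and \<open>h (s - i) = - h i\<close> is
    positive, so each mirror pair of truncated contributions adds up to one untruncated
    weight.\<close>
  also have "(\<Sum>i<?L. F i) + (\<Sum>i<?L. F (s - i)) = (\<Sum>i<?L. walk_weight s i (h i))"
    unfolding sum.distrib[symmetric]
  proof (rule sum.cong)
    fix i assume "i \<in> {..<?L}"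
    then have i: "i \<le> s" by simp
    then show "F i + F (s - i) = walk_weight s i (h i)"
      using walkD(3)[OF assms i]
      by (auto simp: F_def walk_weight_def of_nat_diff algebra_simps)
  qed simp
  finally show ?thesis .
qed

subsection \<open>Maximal walks\<close>

text \<open>The highest path with steps of size at most one that vanishes at 0 and \<open>d\<close>;
  truncated subtraction keeps it at zero beyond \<open>d\<close>.\<close>

definition tent :: "nat \<Rightarrow> nat \<Rightarrow> int" where
  "tent d j = int (min j (d - j))"

text \<open>Removing the two end points of a tent leaves the tent of width smaller by two, raised by
  one. The recursion preserves parity and so fits the parity terms of the closed forms.\<close>

lemma sum_tent_Suc_Suc:
  fixes g :: "nat \<Rightarrow> int \<Rightarrow> int"
  shows "(\<Sum>j\<le>Suc (Suc d). g j (tent (Suc (Suc d)) j))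
    = g 0 0 + (\<Sum>j\<le>d. g (Suc j) (tent d j + 1)) + g (Suc (Suc d)) 0"
proof -
  have "(\<Sum>j\<le>Suc (Suc d). g j (tent (Suc (Suc d)) j))
    = g 0 0 + (\<Sum>j\<le>Suc d. g (Suc j) (tent (Suc (Suc d)) (Suc j)))"
    by (subst sum.atMost_Suc_shift) (simp add: tent_def)
  also have "\<dots> = g 0 0 + (\<Sum>j\<le>d. g (Suc j) (tent (Suc (Suc d)) (Suc j))) + g (Suc (Suc d)) 0"
    by (simp add: tent_def)
  also have "(\<Sum>j\<le>d. g (Suc j) (tent (Suc (Suc d)) (Suc j))) = (\<Sum>j\<le>d. g (Suc j) (tent d j + 1))"
  proof (rule sum.cong)
    fix j assume "j \<in> {..d}"
    then have "tent (Suc (Suc d)) (Suc j) = tent d j + 1"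
      by (auto simp: tent_def min_def)
    then show "g (Suc j) (tent (Suc (Suc d)) (Suc j)) = g (Suc j) (tent d j + 1)" by simp
  qed simp
  finally show ?thesis .
qed

lemma sum_tent: "4 * (\<Sum>j\<le>d. tent d j) = (int d)\<^sup>2 - int d mod 2"
proof (induction d rule: induct_nat_012)
  case (ge2 d)
  have "4 * (\<Sum>j\<le>Suc (Suc d). tent (Suc (Suc d)) j) = 4 * (\<Sum>j\<le>d. tent d j) + 4 * (int d + 1)"
    using sum_tent_Suc_Suc[of "\<lambda>j t. t" d] by (simp add: sum.distrib)
  then show ?case
    using ge2(1) by (simp add: power2_eq_square algebra_simps)
qed (simp_all add: tent_def)

lemma sum_tent_power2:
  "12 * (\<Sum>j\<le>d. (tent d j)\<^sup>2) = int d ^ 3 + 2 * int d - 3 * int d * (int d mod 2)"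
proof (induction d rule: induct_nat_012)
  case (ge2 d)
  have "12 * (\<Sum>j\<le>Suc (Suc d). (tent (Suc (Suc d)) j)\<^sup>2)
    = 12 * (\<Sum>j\<le>d. (tent d j)\<^sup>2) + 6 * (4 * (\<Sum>j\<le>d. tent d j)) + 12 * (int d + 1)"
    using sum_tent_Suc_Suc[of "\<lambda>j t. t\<^sup>2" d]
    by (simp add: power2_sum sum.distrib sum_distrib_left[symmetric] algebra_simps)
  then show ?case
    unfolding sum_tent ge2(1) by (simp add: power2_eq_square power3_eq_cube algebra_simps)
qed (simp_all add: tent_def)

text \<open>The tent is invariant under \<open>j \<mapsto> d - j\<close>, so its centre of mass is
  \<open>d / 2\<close>.\<close>

lemma sum_index_mult_tent: "2 * (\<Sum>j\<le>d. int j * tent d j) = int d * (\<Sum>j\<le>d. tent d j)"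
proof -
  have "(\<Sum>j\<le>d. int j * tent d j) = (\<Sum>j\<le>d. int (d - j) * tent d j)"
    by (rule sum.reindex_bij_witness[of _ "\<lambda>j. d - j" "\<lambda>j. d - j"])
      (auto simp: tent_def min.commute)
  also have "\<dots> = int d * (\<Sum>j\<le>d. tent d j) - (\<Sum>j\<le>d. int j * tent d j)"
    by (simp add: sum_distrib_left sum_subtractf[symmetric] of_nat_diff algebra_simps
        cong: sum.cong_simp)
  finally show ?thesis by simp
qed

text \<open>Serves both halves of an extremal walk: \<open>\<sigma>\<close> is 1 for the tent above
  the axis and -1 for the one below, and \<open>c\<close> absorbs the shift of the index.\<close>

lemma sum_tent_weight:
  "12 * (\<Sum>j\<le>d. m * (tent d j)\<^sup>2 - \<sigma> * (c - 2 * int j) * tent d j)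
    = m * (int d ^ 3 + 2 * int d - 3 * int d * (int d mod 2))
      - 3 * \<sigma> * (c - int d) * ((int d)\<^sup>2 - int d mod 2)"
proof -
  have "(\<Sum>j\<le>d. m * (tent d j)\<^sup>2 - \<sigma> * (c - 2 * int j) * tent d j)
    = m * (\<Sum>j\<le>d. (tent d j)\<^sup>2) - \<sigma> * c * (\<Sum>j\<le>d. tent d j)
      + \<sigma> * (2 * (\<Sum>j\<le>d. int j * tent d j))"
    by (simp add: sum_distrib_left sum_subtractf[symmetric] sum.distrib[symmetric] algebra_simps)
  then have "12 * (\<Sum>j\<le>d. m * (tent d j)\<^sup>2 - \<sigma> * (c - 2 * int j) * tent d j)
    = m * (12 * (\<Sum>j\<le>d. (tent d j)\<^sup>2)) - 3 * \<sigma> * (c - int d) * (4 * (\<Sum>j\<le>d. tent d j))"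
    unfolding sum_index_mult_tent by (simp add: algebra_simps)
  then show ?thesis unfolding sum_tent sum_tent_power2 .
qed

text \<open>The pointwise extremal walk among those whose first zero is at \<open>z\<close>.\<close>

definition extremal :: "nat \<Rightarrow> nat \<Rightarrow> nat \<Rightarrow> int" where
  "extremal s z i = (if i < z then tent (Suc z) (Suc i) else - tent (s div 2 - z) (i - z))"

text \<open>Twelve times the total weight of an extremal walk; here \<open>a = z + 1\<close>, \<open>b = s div 2 - z\<close>,
  \<open>d\<close>, \<open>e\<close>, \<open>f\<close> are the parities of \<open>s\<close>, \<open>a\<close>, \<open>b\<close>, so that \<open>s + 1 = 2 * (a + b) - 1 + d\<close>.\<close>

definition total_poly :: "int \<Rightarrow> int \<Rightarrow> int \<Rightarrow> int \<Rightarrow> int \<Rightarrow> int" where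
  "total_poly d a b e f =
     (2 * (a + b) - 1 + d) * (a ^ 3 + 2 * a - 3 * a * e + b ^ 3 + 2 * b - 3 * b * f)
     - 3 * (a\<^sup>2 - e) * (a + 2 * b + d) + 3 * (b\<^sup>2 - f) * (b + d)"

lemma sum_extremal:
  assumes "z \<le> s div 2"
  shows "12 * (\<Sum>i<s div 2. walk_weight s i (extremal s z i))
    = total_poly (int s mod 2) (int z + 1) (int (s div 2 - z))
        ((int z + 1) mod 2) (int (s div 2 - z) mod 2)"
proof -
  let ?L = "s div 2"
  have s: "int s = 2 * int ?L + int s mod 2" by presburger
  have "(\<Sum>i<?L. walk_weight s i (extremal s z i))
    = (\<Sum>i<z. walk_weight s i (extremal s z i)) + (\<Sum>i=z..<?L. walk_weight s i (extremal s z i))"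
    using assms sum.atLeastLessThan_concat[of 0 z ?L "\<lambda>i. walk_weight s i (extremal s z i)"]
    by (simp add: lessThan_atLeast0)
  \<comment> \<open>The upper tent has its left foot at the virtual position -1, because the walk
    may start at height 1. With \<open>j = i + 1\<close> the factor \<open>s - 2 * i\<close> becomes
    \<open>s + 2 - 2 * j\<close>.\<close>
  moreover have "(\<Sum>i<z. walk_weight s i (extremal s z i))
    = (\<Sum>j\<le>Suc z. (int s + 1) * (tent (Suc z) j)\<^sup>2 - 1 * (int s + 2 - 2 * int j) * tent (Suc z) j)"
  proof -
    have "(\<Sum>i<z. walk_weight s i (extremal s z i))
      = (\<Sum>i<z. (int s + 1) * (tent (Suc z) (Suc i))\<^sup>2
          - 1 * (int s + 2 - 2 * int (Suc i)) * tent (Suc z) (Suc i))"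
      by (rule sum.cong) (auto simp: walk_weight_def extremal_def)
    moreover have "{..z} = insert z {..<z}" by auto
    ultimately show ?thesis
      by (subst sum.atMost_Suc_shift) (simp add: tent_def)
  qed
  moreover have "(\<Sum>i=z..<?L. walk_weight s i (extremal s z i))
    = (\<Sum>j\<le>?L - z. (int s + 1) * (tent (?L - z) j)\<^sup>2
        - (- 1) * (int s - 2 * int z - 2 * int j) * tent (?L - z) j)"
  proof -
    have "(\<Sum>i=z..<?L. walk_weight s i (extremal s z i))
      = (\<Sum>j<?L - z. (int s + 1) * (tent (?L - z) j)\<^sup>2
          - (- 1) * (int s - 2 * int z - 2 * int j) * tent (?L - z) j)"
      by (rule sum.reindex_bij_witness[of _ "\<lambda>j. j + z" "\<lambda>i. i - z"])
        (auto simp: walk_weight_def extremal_def algebra_simps of_nat_diff)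
    moreover have "{..?L - z} = insert (?L - z) {..<?L - z}" by auto
    ultimately show ?thesis by (simp add: tent_def)
  qed
  ultimately have eq: "12 * (\<Sum>i<?L. walk_weight s i (extremal s z i))
    = 12 * (\<Sum>j\<le>Suc z. (int s + 1) * (tent (Suc z) j)\<^sup>2 - 1 * (int s + 2 - 2 * int j) * tent (Suc z) j)
    + 12 * (\<Sum>j\<le>?L - z. (int s + 1) * (tent (?L - z) j)\<^sup>2
        - (- 1) * (int s - 2 * int z - 2 * int j) * tent (?L - z) j)"
    by simp
  define a b d where "a = int z + 1" and "b = int (?L - z)" and "d = int s mod 2"
  have abd: "int (Suc z) = a" "int (?L - z) = b" "int s = 2 * (a + b) - 2 + d" "int z = a - 1"
    using assms s by (simp_all add: a_def b_def d_def of_nat_diff)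
  have "12 * (\<Sum>i<?L. walk_weight s i (extremal s z i)) = total_poly d a b (a mod 2) (b mod 2)"
    unfolding eq sum_tent_weight total_poly_def abd by (simp add: algebra_simps)
  then show ?thesis by (simp only: a_def b_def d_def)
qed

text \<open>After shifting \<open>a\<close> and \<open>b\<close> to their least admissible values, all coefficients of the difference
  are nonnegative.\<close>

lemma total_poly_less_even:
  assumes d: "0 \<le> d" "d \<le> 1" and pos: "1 \<le> a" "1 \<le> b" and even: "even (a + b)"
  shows "total_poly d a b (a mod 2) (b mod 2) < total_poly d (a + b) 0 0 0"
proof (cases "even a")
  case True
  then have "even b" using even by simp
  then have par: "a mod 2 = 0" "b mod 2 = 0" using True by presburger+
  have "2 \<le> a" "2 \<le> b" using par pos by presburger+
  then obtain x y where xy: "a = 2 + x" "b = 2 + y" "0 \<le> x" "0 \<le> y"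
    by (metis add_diff_cancel_left' diff_ge_0_iff_ge diff_add_cancel add.commute)
  have "total_poly d (a + b) 0 0 0 - total_poly d a b 0 0
    = 192 + (192 * y + 60 * y^2 + 6 * y^3 + 288 * x + 24 * x * d + 264 * x * y
        + 18 * x * y * d + 72 * x * y^2 + 3 * x * y^2 * d + 6 * x * y^3 + 108 * x^2
        + 6 * x^2 * d + 78 * x^2 * y + 3 * x^2 * y * d + 12 * x^2 * y^2 + 12 * x^3
        + 6 * x^3 * y)"
    unfolding total_poly_def xy by (simp add: power2_eq_square power3_eq_cube algebra_simps)
  also have "\<dots> > 0"
    using d xy by (intro add_pos_nonneg add_nonneg_nonneg mult_nonneg_nonneg zero_le_power) auto
  finally show ?thesis using par by simp
next
  case False
  then have "odd b" using even by simp
  then have par: "a mod 2 = 1" "b mod 2 = 1" using False by presburger+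
  obtain x y where xy: "a = 1 + x" "b = 1 + y" "0 \<le> x" "0 \<le> y"
    using pos by (metis add_diff_cancel_left' diff_ge_0_iff_ge diff_add_cancel add.commute)
  \<comment> \<open>The terms in \<open>y\<close> alone carry negative coefficients of
    \<open>d\<close>; they are collected with the factor \<open>1 - d\<close>, and here
    \<open>d \<le> 1\<close> enters.\<close>
  have "total_poly d (a + b) 0 0 0 - total_poly d a b 1 1
    = 12 + (12 * y + 3 * y^2 + 42 * x + 6 * x * d + 60 * x * y + 6 * x * y * d + 30 * x * y^2
        + 3 * x * y^2 * d + 6 * x * y^3 + 30 * x^2 + 3 * x^2 * d + 36 * x^2 * y
        + 3 * x^2 * y * d + 12 * x^2 * y^2 + 6 * x^3 + 6 * x^3 * y)
      + (1 - d) * (6 * y + 3 * y^2)"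
    unfolding total_poly_def xy by (simp add: power2_eq_square power3_eq_cube algebra_simps)
  also have "\<dots> > 0"
    using d xy by (intro add_pos_nonneg add_nonneg_nonneg mult_nonneg_nonneg zero_le_power) auto
  finally show ?thesis using par by simp
qed

text \<open>Since \<open>a + b = s div 2 + 1\<close>, an odd sum means an even midpoint; the
  competitor with \<open>a = 1\<close> has its first zero at 0. Excluding \<open>a = 1\<close>, the
  least values of \<open>(a, b)\<close> are \<open>(2, 1)\<close> and \<open>(3, 0)\<close>.\<close>

lemma total_poly_less_odd:
  assumes d: "0 \<le> d" and pos: "2 \<le> a" "0 \<le> b" and odd: "odd (a + b)"
  shows "total_poly d a b (a mod 2) (b mod 2) < total_poly d 1 (a + b - 1) 1 0"
proof (cases "even a")
  case True
  then have "odd b" using odd by simp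
  then have par: "a mod 2 = 0" "b mod 2 = 1" using True by presburger+
  have "1 \<le> b" using par pos by presburger
  then obtain x y where xy: "a = 2 + x" "b = 1 + y" "0 \<le> x" "0 \<le> y"
    using pos by (metis add_diff_cancel_left' diff_ge_0_iff_ge diff_add_cancel add.commute)
  have "total_poly d 1 (a + b - 1) 1 0 - total_poly d a b 0 1
    = 72 + (24 * d + 114 * y + 18 * y * d + 48 * y^2 + 3 * y^2 * d + 6 * y^3 + 96 * x
        + 24 * x * d + 144 * x * y + 18 * x * y * d + 54 * x * y^2 + 3 * x * y^2 * d
        + 6 * x * y^3 + 42 * x^2 + 6 * x^2 * d + 54 * x^2 * y + 3 * x^2 * y * d
        + 12 * x^2 * y^2 + 6 * x^3 + 6 * x^3 * y)"
    unfolding total_poly_def xy by (simp add: power2_eq_square power3_eq_cube algebra_simps)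
  also have "\<dots> > 0"
    using d xy by (intro add_pos_nonneg add_nonneg_nonneg mult_nonneg_nonneg zero_le_power) auto
  finally show ?thesis using par by simp
next
  case False
  then have "even b" using odd by simp
  then have par: "a mod 2 = 1" "b mod 2 = 0" using False by presburger+
  have "3 \<le> a" using par pos by presburger
  then obtain x where x: "a = 3 + x" "0 \<le> x"
    by (metis add_diff_cancel_left' diff_ge_0_iff_ge diff_add_cancel add.commute)
  have "total_poly d 1 (a + b - 1) 1 0 - total_poly d a b 1 0
    = 36 + (24 * d + 120 * b + 24 * b * d + 72 * b^2 + 6 * b^2 * d + 12 * b^3 + 30 * x
        + 18 * x * d + 132 * x * b + 18 * x * b * d + 60 * x * b^2 + 3 * x * b^2 * d
        + 6 * x * b^3 + 6 * x^2 + 3 * x^2 * d + 48 * x^2 * b + 3 * x^2 * b * d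
        + 12 * x^2 * b^2 + 6 * x^3 * b)"
    unfolding total_poly_def x by (simp add: power2_eq_square power3_eq_cube algebra_simps)
  also have "\<dots> > 0"
    using d x pos by (intro add_pos_nonneg add_nonneg_nonneg mult_nonneg_nonneg zero_le_power) auto
  finally show ?thesis using par by simp
qed

section \<open>The best position of the first zero\<close>

text \<open>In both cases the left half becomes a single tent of even width: \<open>s div 2\<close>
  below the axis, or \<open>s div 2 + 1\<close> above it.\<close>

definition best_zero :: "nat \<Rightarrow> nat" where
  "best_zero s = (if even (s div 2) then 0 else s div 2)"

lemma best_zero_le: "best_zero s \<le> s div 2"
  by (simp add: best_zero_def)

lemma sum_extremal_less:
  assumes "z \<le> s div 2" "z \<noteq> best_zero s"
  shows "(\<Sum>i<s div 2. walk_weight s i (extremal s z i))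
    < (\<Sum>i<s div 2. walk_weight s i (extremal s (best_zero s) i))"
proof -
  let ?L = "s div 2" and ?b = "int (s div 2 - z)"
  have "12 * (\<Sum>i<?L. walk_weight s i (extremal s z i))
    < 12 * (\<Sum>i<?L. walk_weight s i (extremal s (best_zero s) i))"
  proof (cases "even ?L")
    case True
    then have best: "best_zero s = 0" by (simp add: best_zero_def)
    have "int z + 1 + ?b - 1 = int ?L" "(int ?L) mod 2 = 0"
      using assms(1) True by (simp_all add: of_nat_diff)
    then show ?thesis
      using total_poly_less_odd[of "int s mod 2" "int z + 1" ?b] assms True
      unfolding best sum_extremal[OF assms(1)] sum_extremal[of 0 s, OF le0]
      by (simp add: of_nat_diff)
  next
    case False
    then have best: "best_zero s = ?L" by (simp add: best_zero_def)
    have "int z + 1 + ?b = int ?L + 1"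
      using assms(1) by (simp add: of_nat_diff)
    moreover have "odd (int ?L)" using False by simp
    then have "(int ?L + 1) mod 2 = 0" by presburger
    ultimately show ?thesis
      using total_poly_less_even[of "int s mod 2" "int z + 1" ?b] assms False
      unfolding best sum_extremal[OF assms(1)] sum_extremal[of ?L s, OF order_refl]
      by (simp add: of_nat_diff add.commute)
  qed
  then show ?thesis by simp
qed

section \<open>Pointwise bounds for the weight of a walk\<close>

lemma walk_lipschitz:
  assumes "walk s h" "i \<le> j" "j \<le> s"
  shows "\<bar>h j - h i\<bar> \<le> int j - int i"
  using assms(2,3)
proof (induction j rule: dec_induct)
  case (step n)
  then show ?case using walkD(2)[OF assms(1), of n] by simp
qed simp

text \<open>The difference factors as \<open>(d - c) * ((s + 1) * (d + c) - (s - 2 * i))\<close>,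
  and \<open>d + c \<ge> 1\<close> makes the second factor positive.\<close>

lemma walk_weight_less_pos:
  assumes "0 \<le> c" "c < d"
  shows "walk_weight s i c < walk_weight s i d"
proof -
  have "(int s + 1) * 1 \<le> (int s + 1) * (d + c)"
    using assms by (intro mult_left_mono) auto
  moreover have "int s - 2 * int i < (int s + 1) * 1" by simp
  ultimately have "0 < (int s + 1) * (d + c) - (int s - 2 * int i)"
    by (simp only: diff_gt_0_iff_gt less_le_trans)
  then have "0 < (d - c) * ((int s + 1) * (d + c) - (int s - 2 * int i))"
    using assms by (intro mult_pos_pos) auto
  also have "\<dots> = walk_weight s i d - walk_weight s i c"
    by (simp add: walk_weight_def power2_eq_square algebra_simps)
  finally show ?thesis by simp
qed

text \<open>The quadratic term depends only on the absolute value, while on the left half the linear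
  term favours negative heights; so the lowest admissible height wins strictly.\<close>

lemma walk_weight_less_neg:
  assumes "\<bar>c\<bar> \<le> d" "c \<noteq> - d" "2 * i < s"
  shows "walk_weight s i c < walk_weight s i (- d)"
proof -
  have "0 \<le> (int s + 1) * ((d + c) * (d - c))"
    using assms by (intro mult_nonneg_nonneg) auto
  moreover have "0 < (int s - 2 * int i) * (d + c)"
    using assms by (intro mult_pos_pos) auto
  moreover have "walk_weight s i (- d) - walk_weight s i c
    = (int s + 1) * ((d + c) * (d - c)) + (int s - 2 * int i) * (d + c)"
    by (simp add: walk_weight_def power2_eq_square algebra_simps)
  ultimately show ?thesis by linarith
qed

text \<open>Before \<open>z\<close> the heights are positive and bounded by the distance to
  \<open>z\<close> and by the start, so higher is better. After \<open>z\<close> their absolute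
  values are bounded by the distances to the zeros at \<open>z\<close> and \<open>s div 2\<close>,
  so lower is better.\<close>

lemma walk_weight_le_extremal:
  assumes h: "walk s h" and z: "z \<le> s div 2" "h z = 0" "\<And>j. j < z \<Longrightarrow> h j \<noteq> 0"
    and i: "i < s div 2"
  shows "walk_weight s i (h i) < walk_weight s i (extremal s z i) \<or> h i = extremal s z i"
proof (cases "i < z")
  case True
  \<comment> \<open>The walk starts at 1 and cannot cross the axis without visiting 0.\<close>
  have pos: "0 < h j" if "j < z" for j
    using that
  proof (induction j)
    case 0
    then show ?case using walkD(1)[OF h] z(3)[of 0] by auto
  next
    case (Suc j)
    then have "j < s" using z(1) div_le_dividend[of s 2] by linarith
    then have "\<bar>h (Suc j) - h j\<bar> \<le> 1" by (rule walkD(2)[OF h])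
    then show ?case using Suc z(3)[of "Suc j"] by simp
  qed
  have "i \<le> s" using i by simp
  then have "h i \<le> int i + 1"
    using walk_lipschitz[OF h, of 0 i] walkD(1)[OF h] by auto
  moreover have "h i \<le> int z - int i"
    using walk_lipschitz[OF h, of i z] True z(1,2) div_le_dividend[of s 2] by simp
  ultimately have "h i \<le> extremal s z i"
    using True by (simp add: extremal_def tent_def min_def)
  then show ?thesis
    using walk_weight_less_pos[of "h i" "extremal s z i" s i] pos[OF True] by fastforce
next
  case False
  have "\<bar>h i\<bar> \<le> int i - int z"
    using walk_lipschitz[OF h, of z i] False i z(2) by simp
  moreover have "\<bar>h i\<bar> \<le> int (s div 2) - int i"
    using walk_lipschitz[OF h, of i "s div 2"] walk_mid_eq_0[OF h, of "s div 2"] i by simp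
  ultimately have "\<bar>h i\<bar> \<le> tent (s div 2 - z) (i - z)"
    using False i by (simp add: tent_def min_def of_nat_diff)
  then show ?thesis
    using walk_weight_less_neg[of "h i" "tent (s div 2 - z) (i - z)" i s] False i
    by (auto simp: extremal_def)
qed

text \<open>A loss is strict either because the first zero is misplaced or because some height
  differs from the extremal one. The strict alternative is what later yields uniqueness.\<close>

lemma sum_walk_weight_less:
  assumes h: "walk s h"
  shows "(\<Sum>i<s div 2. walk_weight s i (h i))
      < (\<Sum>i<s div 2. walk_weight s i (extremal s (best_zero s) i))
    \<or> (\<forall>i<s div 2. h i = extremal s (best_zero s) i)"
proof -
  let ?L = "s div 2"
  have mid: "h ?L = 0" using walk_mid_eq_0[OF h, of ?L] by simp
  define z where "z = (LEAST z. h z = 0)"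
  have z: "h z = 0" "z \<le> ?L"
    unfolding z_def using LeastI[of "\<lambda>z. h z = 0", OF mid] Least_le[of "\<lambda>z. h z = 0", OF mid] by auto
  have nz: "h j \<noteq> 0" if "j < z" for j
    using not_less_Least[of j "\<lambda>z. h z = 0"] that by (simp add: z_def)
  have le: "walk_weight s i (h i) < walk_weight s i (extremal s z i) \<or> h i = extremal s z i"
    if "i < ?L" for i
    using walk_weight_le_extremal[OF h z(2,1) nz that] .
  then have sum_le: "(\<Sum>i<?L. walk_weight s i (h i)) \<le> (\<Sum>i<?L. walk_weight s i (extremal s z i))"
    by (intro sum_mono) force
  show ?thesis
  proof (cases "z = best_zero s")
    case False
    then show ?thesis using sum_extremal_less[OF z(2)] sum_le by simp
  next
    case True
    show ?thesis
    proof (cases "\<forall>i<?L. h i = extremal s z i")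
      case False
      then obtain j where "j < ?L" "walk_weight s j (h j) < walk_weight s j (extremal s z j)"
        using le by blast
      then have "(\<Sum>i<?L. walk_weight s i (h i)) < (\<Sum>i<?L. walk_weight s i (extremal s z i))"
        using le by (intro sum_strict_mono_ex1) force+
      then show ?thesis using True by simp
    qed (use True in simp)
  qed
qed

section \<open>The optimal walk and its weight\<close>

definition best_walk :: "nat \<Rightarrow> nat \<Rightarrow> int" where
  "best_walk s i = (if i \<le> s div 2 then extremal s (best_zero s) i
     else - extremal s (best_zero s) (s - i))"

lemma extremal_best_step:
  assumes "i < s div 2"
  shows "\<bar>extremal s (best_zero s) (Suc i) - extremal s (best_zero s) i\<bar> \<le> 1"
  using assms by (auto simp: extremal_def best_zero_def tent_def min_def of_nat_diff)

lemma extremal_best_mid: "extremal s (best_zero s) (s div 2) = 0"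
  by (auto simp: extremal_def best_zero_def tent_def)

lemma walk_best_walk: "walk s (best_walk s)"
  unfolding walk_def
proof (intro conjI allI impI)
  let ?L = "s div 2" and ?e = "extremal s (best_zero s)"
  show "best_walk s 0 \<in> {0, 1}"
    by (auto simp: best_walk_def extremal_def best_zero_def tent_def elim!: oddE)
  show refl: "best_walk s (s - i) = - best_walk s i" if "i \<le> s" for i
  proof -
    consider "i < ?L" | "i = ?L" "s - i = ?L" | "i = ?L" "?L < s - i" | "?L < i"
      by linarith
    then show ?thesis
      using that extremal_best_mid[of s] by cases (auto simp: best_walk_def)
  qed
  have left: "\<bar>best_walk s (Suc i) - best_walk s i\<bar> \<le> 1" if "i < ?L" for i
    using extremal_best_step[OF that] that by (simp add: best_walk_def)
  fix i assume i: "i < s"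
  \<comment> \<open>Steps right of the midpoint are mirror images of steps on the left; for odd
    \<open>s\<close> the middle step joins two zeros.\<close>
  consider "i < ?L" | "i = ?L" "even s" | "i = ?L" "odd s" | "?L < i"
    by linarith
  then show "\<bar>best_walk s (Suc i) - best_walk s i\<bar> \<le> 1"
  proof cases
    case 2
    then have "s - Suc i < ?L" "Suc (s - Suc i) = ?L" using i by presburger+
    then show ?thesis
      using left[of "s - Suc i"] refl[of "Suc i"] extremal_best_mid[of s] 2 i
      by (simp add: best_walk_def)
  next
    case 3
    then have "s - Suc i = ?L" by presburger
    then show ?thesis
      using refl[of "Suc i"] extremal_best_mid[of s] 3 i by (simp add: best_walk_def)
  next
    case 4
    then have "s - Suc i < ?L" "Suc (s - Suc i) = s - i" using i by presburger+
    then show ?thesis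
      using left[of "s - Suc i"] refl[of "Suc i"] refl[of i] i by simp
  qed (use left in simp)
qed

definition best_weight :: "nat \<Rightarrow> int" where
  "best_weight s = (\<Sum>i<s div 2. walk_weight s i (best_walk s i))"

lemma best_weight_eq:
  "12 * best_weight s = (if even (s div 2)
     then (int s + 1) * (int (s div 2) ^ 3 + 2 * int (s div 2))
       + 3 * int (s div 2) ^ 2 * (int s - int (s div 2))
     else (int s + 1) * ((int (s div 2) + 1) ^ 3 + 2 * (int (s div 2) + 1))
       - 3 * (int (s div 2) + 1) ^ 2 * (int s + 1 - int (s div 2)))"
proof -
  let ?L = "s div 2"
  have "best_weight s = (\<Sum>i<?L. walk_weight s i (extremal s (best_zero s) i))"
    by (simp add: best_weight_def best_walk_def)
  moreover have "int s = 2 * int ?L + int s mod 2" by presburger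
  then have "int s mod 2 = int s - 2 * int ?L" by simp
  ultimately have sum: "12 * best_weight s = total_poly (int s - 2 * int ?L) (int (best_zero s) + 1)
      (int (?L - best_zero s)) ((int (best_zero s) + 1) mod 2) (int (?L - best_zero s) mod 2)"
    using sum_extremal[OF best_zero_le, of s] by simp
  show ?thesis
  proof (cases "even ?L")
    case True
    then have "int ?L mod 2 = 0" by simp
    then show ?thesis
      using sum True
      by (simp add: best_zero_def total_poly_def power2_eq_square power3_eq_cube algebra_simps)
  next
    case False
    then have "odd (int ?L)" by simp
    then have "(int ?L + 1) mod 2 = 0" by presburger
    then show ?thesis
      using sum False
      by (simp add: best_zero_def total_poly_def power2_eq_square power3_eq_cube algebra_simps)
  qed
qed

lemma walk_eq_best_walk:
  assumes h: "walk s h" and eq: "\<forall>i<s div 2. h i = extremal s (best_zero s) i" and i: "i \<le> s"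
  shows "h i = best_walk s i"
proof -
  have left: "h j = best_walk s j" if "j \<le> s div 2" for j
  proof (cases "j = s div 2")
    case True
    then show ?thesis
      using walk_mid_eq_0[OF h, of j] walk_mid_eq_0[OF walk_best_walk, of j] by simp
  qed (use that eq in \<open>simp add: best_walk_def\<close>)
  show ?thesis
  proof (cases "i \<le> s div 2")
    case False
    then have "s - i \<le> s div 2" by linarith
    then show ?thesis
      using left[of "s - i"] walkD(3)[OF h i] walkD(3)[OF walk_best_walk i] by simp
  qed (rule left)
qed

section \<open>Passing between cores and walks, and the maximal size\<close>

lemma core_walk:
  assumes "p \<in> self_conjugate_cores [s, s + 1, s + 2]" "1 \<le> s"
  obtains h where "walk s h" "maya p = abacus s h"
    "int (partition_size p) = (\<Sum>i<s div 2. walk_weight s i (h i))"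
proof -
  have p: "is_partition p" "self_conjugate p"
    using assms(1) by (auto simp: self_conjugate_cores_def)
  have core: "is_core a p" if "a \<in> {s, s + 1, s + 2}" for a
    using assms(1) that by (auto simp: self_conjugate_cores_def simultaneous_core_def)
  have "\<exists>h. walk s h \<and> maya p = abacus s h"
  proof (rule ex_walk_of_closed_maya[OF symmetric_maya_maya[OF p]])
    fix x a assume xa: "x \<in> maya p" "a \<in> {s, s + 1, s + 2}"
    then have "0 < a" using assms(2) by auto
    then show "x - int a \<in> maya p"
      using core[OF xa(2)] is_core_iff[OF p] xa(1) by blast
  qed
  then obtain h where h: "walk s h" "maya p = abacus s h" by blast
  then show thesis
    using that partition_size_eq_sum_maya[OF p] sum_abacus[OF h(1)] by simp
qed

lemma ex_core_of_walk:
  assumes h: "walk s h" and "1 \<le> s"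
  shows "\<exists>p \<in> self_conjugate_cores [s, s + 1, s + 2]. maya p = abacus s h"
proof -
  obtain p where p: "is_partition p" "self_conjugate p" "maya p = abacus s h"
    using ex_self_conjugate_maya[OF symmetric_maya_abacus[OF h]] by blast
  have "is_core a p" if "a \<in> {s, s + 1, s + 2}" for a
    using is_core_iff[OF p(1,2), of a] abacus_closed[OF h _ that] p(3) that assms(2) by auto
  then show ?thesis
    using p by (auto simp: self_conjugate_cores_def simultaneous_core_def)
qed

text \<open>The midpoint \<open>s div 2\<close> is \<open>2 * w\<close>, \<open>2 * w - 1\<close>,
  \<open>2 * w - 1\<close> and \<open>2 * w - 2\<close> in the four cases, which selects the branch
  of \<open>best_weight_eq\<close>. The factor 3 keeps the identities within the integers.\<close>

lemma best_weight_closed_form: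
  "s = 4 * w \<Longrightarrow>
    3 * best_weight s = int w * (2 * int w + 1) * (4 * (int w)\<^sup>2 + 2 * int w + 1)"
  "s + 1 = 4 * w \<Longrightarrow> 3 * best_weight s = (int w)\<^sup>2 * (8 * (int w)\<^sup>2 - 6 * int w + 1)"
  "s + 2 = 4 * w \<Longrightarrow>
    3 * best_weight s = int w * (2 * int w - 1) * (4 * (int w)\<^sup>2 - 2 * int w + 1)"
  "s + 3 = 4 * w \<Longrightarrow>
    3 * best_weight s = (int w - 1) * (2 * int w - 1) * (4 * (int w)\<^sup>2 - 5 * int w + 3)"
proof -
  show "3 * best_weight s = int w * (2 * int w + 1) * (4 * (int w)\<^sup>2 + 2 * int w + 1)" if "s = 4 * w"
  proof -
    have "s div 2 = 2 * w" "int s = 4 * int w" using that by simp_all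
    then show ?thesis
      using best_weight_eq[of s] by (simp add: power2_eq_square power3_eq_cube algebra_simps)
  qed
  show "3 * best_weight s = (int w)\<^sup>2 * (8 * (int w)\<^sup>2 - 6 * int w + 1)" if "s + 1 = 4 * w"
  proof -
    have par: "odd (s div 2)" and eq: "int (s div 2) = 2 * int w - 1" "int s = 4 * int w - 1"
      using that by presburger+
    show ?thesis
      using best_weight_eq[of s] par unfolding eq by (simp add: power2_eq_square power3_eq_cube algebra_simps)
  qed
  show "3 * best_weight s = int w * (2 * int w - 1) * (4 * (int w)\<^sup>2 - 2 * int w + 1)"
    if "s + 2 = 4 * w"
  proof -
    have par: "odd (s div 2)" and eq: "int (s div 2) = 2 * int w - 1" "int s = 4 * int w - 2"
      using that by presburger+
    show ?thesis
      using best_weight_eq[of s] par unfolding eq by (simp add: power2_eq_square power3_eq_cube algebra_simps)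
  qed
  show "3 * best_weight s = (int w - 1) * (2 * int w - 1) * (4 * (int w)\<^sup>2 - 5 * int w + 3)"
    if "s + 3 = 4 * w"
  proof -
    have par: "even (s div 2)" and eq: "int (s div 2) = 2 * int w - 2" "int s = 4 * int w - 3"
      using that by presburger+
    show ?thesis
      using best_weight_eq[of s] par unfolding eq by (simp add: power2_eq_square power3_eq_cube algebra_simps)
  qed
qed

theorem theorem3p3:
  fixes s :: nat
  assumes "s \<ge> 1"
  shows "\<exists>N. is_largest_size (self_conjugate_cores [s, s + 1, s + 2]) N \<and>
    (\<forall>w::nat. w \<ge> 1 \<longrightarrow>
      (int s = 4 * int w \<longrightarrow>
        real N = real w * (2 * real w + 1) * (4 * real w ^ 2 + 2 * real w + 1) / 3) \<and>
      (int s = 4 * int w - 1 \<longrightarrow>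
        real N = real w ^ 2 * (8 * real w ^ 2 - 6 * real w + 1) / 3) \<and>
      (int s = 4 * int w - 2 \<longrightarrow>
        real N = real w * (2 * real w - 1) * (4 * real w ^ 2 - 2 * real w + 1) / 3) \<and>
      (int s = 4 * int w - 3 \<longrightarrow>
        real N = (real w - 1) * (2 * real w - 1) * (4 * real w ^ 2 - 5 * real w + 3) / 3)) \<and>
    (\<exists>!p. p \<in> self_conjugate_cores [s, s + 1, s + 2] \<and> partition_size p = N)"
proof -
  let ?C = "self_conjugate_cores [s, s + 1, s + 2]"
  have best: "best_weight s = (\<Sum>i<s div 2. walk_weight s i (extremal s (best_zero s) i))"
    by (simp add: best_weight_def best_walk_def)
  \<comment> \<open>One dichotomy gives both claims: every core is strictly smaller than the optimum
    or has the optimal Maya diagram, which determines the partition.\<close>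
  have bound: "int (partition_size p) < best_weight s \<or> maya p = abacus s (best_walk s)"
    if "p \<in> ?C" for p
  proof -
    obtain h where h: "walk s h" "maya p = abacus s h"
      "int (partition_size p) = (\<Sum>i<s div 2. walk_weight s i (h i))"
      using core_walk[OF \<open>p \<in> ?C\<close> assms] .
    from sum_walk_weight_less[OF h(1)] show ?thesis
    proof
      assume "\<forall>i<s div 2. h i = extremal s (best_zero s) i"
      then have "abacus s h = abacus s (best_walk s)"
        by (intro abacus_cong walk_eq_best_walk[OF h(1)])
      then show ?thesis using h(2) by simp
    qed (use h(3) best in simp)
  qed
  have size_best: "int (partition_size p) = best_weight s"
    if "p \<in> ?C" "maya p = abacus s (best_walk s)" for p
    using partition_size_eq_sum_maya[of p] sum_abacus[OF walk_best_walk, of s] that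
    by (simp add: self_conjugate_cores_def best_weight_def)
  obtain q where q: "q \<in> ?C" "maya q = abacus s (best_walk s)"
    using ex_core_of_walk[OF walk_best_walk assms] by blast
  define N where "N = partition_size q"
  have N: "int N = best_weight s" unfolding N_def by (rule size_best[OF q])
  have "partition_size p \<le> N" if "p \<in> ?C" for p
    using bound[OF that] size_best[OF that] N by force
  then have largest: "is_largest_size ?C N"
    using q(1) by (auto simp: is_largest_size_def N_def)
  have unique: "p = q" if "p \<in> ?C" "partition_size p = N" for p
  proof (rule maya_inject)
    show "maya p = maya q" using bound[OF that(1)] that(2) N q(2) by simp
  qed (use that q in \<open>simp_all add: self_conjugate_cores_def\<close>)
  have real_N: "real N = real_of_int c / 3" if "3 * best_weight s = c" for c
  proof -
    have "3 * real N = real_of_int (3 * int N)" by simp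
    also have "\<dots> = real_of_int c" using that N by simp
    finally show ?thesis by simp
  qed
  have "(int s = 4 * int w \<longrightarrow>
        real N = real w * (2 * real w + 1) * (4 * real w ^ 2 + 2 * real w + 1) / 3) \<and>
      (int s = 4 * int w - 1 \<longrightarrow>
        real N = real w ^ 2 * (8 * real w ^ 2 - 6 * real w + 1) / 3) \<and>
      (int s = 4 * int w - 2 \<longrightarrow>
        real N = real w * (2 * real w - 1) * (4 * real w ^ 2 - 2 * real w + 1) / 3) \<and>
      (int s = 4 * int w - 3 \<longrightarrow>
        real N = (real w - 1) * (2 * real w - 1) * (4 * real w ^ 2 - 5 * real w + 3) / 3)" for w
  proof (intro conjI impI)
    assume "int s = 4 * int w"
    then have "s = 4 * w" by linarith
    from real_N[OF best_weight_closed_form(1)[OF this]]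
    show "real N = real w * (2 * real w + 1) * (4 * real w ^ 2 + 2 * real w + 1) / 3" by simp
  next
    assume "int s = 4 * int w - 1"
    then have "s + 1 = 4 * w" by linarith
    from real_N[OF best_weight_closed_form(2)[OF this]]
    show "real N = real w ^ 2 * (8 * real w ^ 2 - 6 * real w + 1) / 3" by simp
  next
    assume "int s = 4 * int w - 2"
    then have "s + 2 = 4 * w" by linarith
    from real_N[OF best_weight_closed_form(3)[OF this]]
    show "real N = real w * (2 * real w - 1) * (4 * real w ^ 2 - 2 * real w + 1) / 3" by simp
  next
    assume "int s = 4 * int w - 3"
    then have "s + 3 = 4 * w" by linarith
    from real_N[OF best_weight_closed_form(4)[OF this]]
    show "real N = (real w - 1) * (2 * real w - 1) * (4 * real w ^ 2 - 5 * real w + 3) / 3" by simp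
  qed
  then show ?thesis
    using largest unique q(1) by (intro exI[of _ N] conjI allI impI ex1I[of _ q]) (auto simp: N_def)
qed

end
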